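(* For all $n\geq1$, $j_n(\{123,213\})=f_{n-1}$, where the Fibonacci numbers are defined by $f_0=f_1=1$ and $f_m=f_{m-1}+f_{m-2}$ for $m\geq2$.
   Context: A permutation of a finite set $S$ of positive integers is a word in which each element of $S$ appears exactly once; $\mathfrak{S}_n$ is the set of permutations of $\{1,\dots,n\}$. For a permutation $\pi$ and a letter $x$ of $\pi$, $\rho_\pi(x)$ is the maximal consecutive subword of $\pi$ consisting of the letters immediately to the right of $x$ that are all larger than $x$. $\pi$ is Jacobi if $|\rho_\pi(x)|$ is even for all letters $x$. A permutation $\pi$ avoids a pattern $\sigma$ if no subword of $\pi$ has standardization (relative order) $\sigma$. For a set $\Pi$ of patterns, $j_n(\Pi)$ is the number of Jacobi permutations in $\mathfrak{S}_n$ avoiding every pattern in $\Pi$. *)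

theory Defs
  imports "HOL-Combinatorics.Multiset_Permutations" "HOL-Library.Sublist"
begin

text \<open>A permutation of a finite set \<open>S\<close> is a word \<open>xs \<in> permutations_of_set S\<close>.\<close>

definition sym_perms :: "nat \<Rightarrow> nat list set" where
  "sym_perms n = permutations_of_set {1..n}"

text \<open>Intended for a word \<open>xs\<close> without repetitions and a letter \<open>x\<close> of \<open>xs\<close>:
  \<open>tl (dropWhile (\<lambda>y. y \<noteq> x) xs)\<close> is the part of \<open>xs\<close> to the right of \<open>x\<close>.\<close>

definition rho :: "nat list \<Rightarrow> nat \<Rightarrow> nat list" where
  "rho xs x = takeWhile (\<lambda>y. x < y) (tl (dropWhile (\<lambda>y. y \<noteq> x) xs))"

definition jacobi :: "nat list \<Rightarrow> bool" where
  "jacobi xs \<longleftrightarrow> (\<forall>x\<in>set xs. even (length (rho xs x)))"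

text \<open>Each letter is replaced by its rank among the letters of the word.\<close>

definition standardize :: "nat list \<Rightarrow> nat list" where
  "standardize xs = map (\<lambda>x. card {y \<in> set xs. y \<le> x}) xs"

text \<open>Subwords in the sense of pattern avoidance need not be consecutive.\<close>

definition avoids :: "nat list \<Rightarrow> nat list \<Rightarrow> bool" where
  "avoids xs p \<longleftrightarrow> (\<nexists>ys. subseq ys xs \<and> standardize ys = p)"

definition jacobi_count :: "nat \<Rightarrow> nat list set \<Rightarrow> nat" where
  "jacobi_count n P = card {xs \<in> sym_perms n. jacobi xs \<and> (\<forall>p\<in>P. avoids xs p)}"

text \<open>Indexing with initial values \<open>1, 1\<close>, unlike the library's \<open>fib\<close>, which starts with \<open>0, 1\<close>.\<close>

fun fibonacci :: "nat \<Rightarrow> nat" where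
  "fibonacci 0 = 1"
| "fibonacci (Suc 0) = 1"
| "fibonacci (Suc (Suc m)) = fibonacci (Suc m) + fibonacci m"

end

theory Submission
  imports Defs
begin

text \<open>
  Avoiding 123 and 213 means that every letter has at most one smaller letter to its left.
  Hence the maximal letter \<open>n\<close> stands first or second. If it is first, deleting it leaves an
  arbitrary admissible permutation of \<open>{1..n-1}\<close>. If the word starts with \<open>a n\<close>, evenness of
  \<open>\<rho>(a)\<close> forces a further letter larger than \<open>a\<close>, so \<open>a \<noteq> n-1\<close>, and then \<open>n-1\<close> must stand
  third; deleting \<open>n\<close> and \<open>n-1\<close> preserves the parity of \<open>\<rho>(a)\<close> and leaves an arbitrary
  admissible permutation of \<open>{1..n-2}\<close>. For \<open>n \<ge> 3\<close> this is the Fibonacci recurrence.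
\<close>

section \<open>Pattern avoidance as a condition on triples\<close>

definition at_most_one_smaller_before :: "nat list \<Rightarrow> bool" where
  "at_most_one_smaller_before xs \<longleftrightarrow> (\<forall>a b c. subseq [a, b, c] xs \<longrightarrow> \<not> (a < c \<and> b < c))"

lemma less_if_rank_less:
  fixes a b :: nat
  assumes "card {y \<in> set xs. y \<le> a} < card {y \<in> set xs. y \<le> b}"
  shows "a < b"
proof (rule ccontr)
  assume "\<not> a < b"
  then have "card {y \<in> set xs. y \<le> b} \<le> card {y \<in> set xs. y \<le> a}"
    by (intro card_mono) auto
  with assms show False by simp
qed

text \<open>The two patterns differ only in the order of their first two letters, so together they
  just require the third letter to be the largest.\<close>

lemma standardize_123_or_213_iff:
  assumes "distinct [a, b, c]"
  shows "standardize [a, b, c] \<in> {[1, 2, 3], [2, 1, 3]} \<longleftrightarrow> a < c \<and> b < c"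
proof
  assume *: "standardize [a, b, c] \<in> {[1, 2, 3], [2, 1, 3]}"
  show "a < c \<and> b < c"
    by (intro conjI; rule less_if_rank_less[of "[a, b, c]"])
       (use * in \<open>auto simp: standardize_def\<close>)
next
  assume *: "a < c \<and> b < c"
  have c: "{y \<in> set [a, b, c]. y \<le> c} = {a, b, c}"
    using * by auto
  consider "a < b" | "b < a" using assms by force
  then show "standardize [a, b, c] \<in> {[1, 2, 3], [2, 1, 3]}"
  proof cases
    case 1
    have "{y \<in> set [a, b, c]. y \<le> a} = {a}" "{y \<in> set [a, b, c]. y \<le> b} = {a, b}"
      using * 1 by auto
    then show ?thesis using c assms by (simp only: standardize_def list.map) simp
  next
    case 2
    have "{y \<in> set [a, b, c]. y \<le> a} = {a, b}" "{y \<in> set [a, b, c]. y \<le> b} = {b}"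
      using * 2 by auto
    then show ?thesis using c assms by (simp only: standardize_def list.map) simp
  qed
qed

text \<open>Standardization preserves length, so only three-letter subwords matter; they inherit
  distinctness from \<open>xs\<close>.\<close>

lemma avoids_123_213_iff:
  assumes "distinct xs"
  shows "(\<forall>p\<in>{[1, 2, 3], [2, 1, 3]}. avoids xs p) \<longleftrightarrow> at_most_one_smaller_before xs"
proof -
  have distinct: "distinct ys" if "subseq ys xs" for ys
    using that assms by (metis distinct_nthsI subseq_conv_nths)
  have "(\<forall>p\<in>{[1, 2, 3], [2, 1, 3]}. avoids xs p) \<longleftrightarrow>
      (\<forall>ys. subseq ys xs \<longrightarrow> standardize ys \<notin> {[1, 2, 3], [2, 1, 3]})"
    by (auto simp: avoids_def)
  also have "\<dots> \<longleftrightarrow>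
      (\<forall>a b c. subseq [a, b, c] xs \<longrightarrow> standardize [a, b, c] \<notin> {[1, 2, 3], [2, 1, 3]})"
  proof (intro iffI allI impI)
    fix ys
    assume *: "\<forall>a b c. subseq [a, b, c] xs \<longrightarrow>
        standardize [a, b, c] \<notin> {[1, 2, 3], [2, 1, 3]}" and "subseq ys xs"
    show "standardize ys \<notin> {[1, 2, 3], [2, 1, 3]}"
    proof
      assume st: "standardize ys \<in> {[1, 2, 3], [2, 1, 3]}"
      then have "length (standardize ys) = 3" by auto
      then have "length ys = Suc (Suc (Suc 0))" by (simp add: standardize_def)
      then obtain a b c where "ys = [a, b, c]"
        by (auto simp: length_Suc_conv)
      with * st \<open>subseq ys xs\<close> show False by blast
    qed
  qed blast
  also have "\<dots> \<longleftrightarrow> at_most_one_smaller_before xs"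
    unfolding at_most_one_smaller_before_def
    using standardize_123_or_213_iff distinct by blast
  finally show ?thesis .
qed

section \<open>Inserting large letters\<close>

text \<open>A letter put in front lies to the right of no other letter, so it leaves their
  \<open>rho\<close> unchanged and contributes only its own.\<close>

lemma jacobi_Cons_iff:
  assumes "x \<notin> set xs"
  shows "jacobi (x # xs) \<longleftrightarrow> even (length (takeWhile (\<lambda>y. x < y) xs)) \<and> jacobi xs"
proof -
  have "rho (x # xs) y = rho xs y" if "y \<in> set xs" for y
    using assms that by (auto simp: rho_def)
  moreover have "rho (x # xs) x = takeWhile (\<lambda>y. x < y) xs"
    by (simp add: rho_def)
  ultimately show ?thesis by (simp add: jacobi_def)
qed

lemma jacobi_Cons_max_iff:
  assumes "\<forall>y\<in>set xs. y < x"
  shows "jacobi (x # xs) \<longleftrightarrow> jacobi xs"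
proof -
  have "takeWhile (\<lambda>y. x < y) xs = []"
    using assms by (cases xs) auto
  with assms show ?thesis by (auto simp: jacobi_Cons_iff)
qed

text \<open>Each of \<open>n\<close> and \<open>m\<close> is followed by a smaller letter or by
  nothing, so its own \<open>rho\<close> is empty, while \<open>rho\<close> of \<open>a\<close>
  gains exactly these two letters.\<close>

lemma jacobi_insert_two_max_iff:
  assumes "a < m" "m < n" "a \<notin> set ys" "\<forall>y\<in>set ys. y < m"
  shows "jacobi (a # n # m # ys) \<longleftrightarrow> jacobi (a # ys)"
proof -
  have "jacobi (n # m # ys) \<longleftrightarrow> jacobi ys"
    using assms by (subst jacobi_Cons_max_iff; force simp: jacobi_Cons_max_iff)
  with assms show ?thesis by (auto simp: jacobi_Cons_iff)
qed

text \<open>A leading maximum could only be the first letter of a forbidden triple, but that letter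
  is smaller than the third.\<close>

lemma at_most_one_smaller_before_Cons_max_iff:
  assumes "\<forall>y\<in>set xs. y < x"
  shows "at_most_one_smaller_before (x # xs) \<longleftrightarrow> at_most_one_smaller_before xs"
proof -
  have x: "\<not> x < c" if "subseq [b, c] xs" for b c
  proof -
    have "subseq [c] xs" using that by (rule subseq_Cons')
    then have "c \<in> set xs" by (simp only: subseq_singleton_left)
    with assms show ?thesis by (meson order.asym)
  qed
  have iff: "subseq [a, b, c] (x # xs) \<longleftrightarrow> (a = x \<and> subseq [b, c] xs) \<or> subseq [a, b, c] xs"
    for a b c
    by (auto simp: subseq_Cons2_iff dest: subseq_Cons')
  show ?thesis
    unfolding at_most_one_smaller_before_def iff using x by meson
qed

text \<open>Only \<open>a\<close> precedes \<open>n\<close>, and only \<open>a\<close> is a smaller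
  letter preceding \<open>m\<close>, so neither can end a forbidden triple. A triple ending in
  \<open>ys\<close> has all its letters below \<open>m\<close> and thus avoids both.\<close>

lemma at_most_one_smaller_before_insert_two_max_iff:
  assumes "a < m" "m < n" "\<forall>y\<in>set ys. y < m"
  shows "at_most_one_smaller_before (a # n # m # ys) \<longleftrightarrow> at_most_one_smaller_before (a # ys)"
proof
  assume *: "at_most_one_smaller_before (a # n # m # ys)"
  have "subseq (a # ys) (a # n # m # ys)" by auto
  with * show "at_most_one_smaller_before (a # ys)"
    unfolding at_most_one_smaller_before_def using subseq_order.trans by blast
next
  assume *: "at_most_one_smaller_before (a # ys)"
  show "at_most_one_smaller_before (a # n # m # ys)"
    unfolding at_most_one_smaller_before_def
  proof (intro allI impI notI)
    fix x y z
    assume sub: "subseq [x, y, z] (a # n # m # ys)" and less: "x < z \<and> y < z"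
    \<comment> \<open>The letter \<open>x\<close> already uses up the first position or a later
      one.\<close>
    have "subseq [y, z] (n # m # ys)"
      using sub by (auto simp: subseq_Cons2_iff dest: subseq_Cons' split: if_splits)
    then have "z \<in> set (m # ys)"
      by (auto simp: subseq_Cons2_iff subseq_singleton_left dest: subseq_Cons'
          split: if_splits)
    moreover have "z \<noteq> m"
    proof
      assume "z = m"
      \<comment> \<open>Since \<open>y < m < n\<close>, the letter \<open>y\<close> is neither
        \<open>n\<close> nor \<open>m\<close>, so it would have to come from
        \<open>ys\<close>.\<close>
      then have "subseq [y, m] ys"
        using \<open>subseq [y, z] (n # m # ys)\<close> less assms
        by (auto simp: subseq_Cons2_iff split: if_splits)
      then have "m \<in> set ys"
        by (auto simp only: subseq_singleton_left dest: subseq_Cons')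
      with assms show False by blast
    qed
    ultimately have "z < m" using assms by auto
    with less assms have "subseq [x, y, z] (a # ys)"
      using sub by (auto simp: subseq_Cons2_iff split: if_splits)
    with * less show False
      unfolding at_most_one_smaller_before_def by blast
  qed
qed

section \<open>Admissible permutations and their recurrence\<close>

definition admissible :: "nat \<Rightarrow> nat list set" where
  "admissible n = {xs. distinct xs \<and> set xs = {1..n} \<and> jacobi xs \<and> at_most_one_smaller_before xs}"

lemma jacobi_count_eq_card_admissible:
  "jacobi_count n {[1, 2, 3], [2, 1, 3]} = card (admissible n)"
proof -
  have "{xs \<in> sym_perms n. jacobi xs \<and> (\<forall>p\<in>{[1, 2, 3], [2, 1, 3]}. avoids xs p)} = admissible n"
    using avoids_123_213_iff
    unfolding sym_perms_def permutations_of_set_def admissible_def by blast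
  then show ?thesis unfolding jacobi_count_def by simp
qed

lemma finite_admissible: "finite (admissible n)"
proof (rule finite_subset)
  show "admissible n \<subseteq> permutations_of_set {1..n}"
    by (auto simp: admissible_def permutations_of_set_def)
qed simp

text \<open>Inverse to deleting the two largest letters when they stand second and third. It is
  meant for nonempty words, since \<open>hd []\<close> is unspecified; hence the recurrence starts
  at \<open>n = 1\<close>.\<close>

definition insert_two_max :: "nat \<Rightarrow> nat list \<Rightarrow> nat list" where
  "insert_two_max n xs = hd xs # (n + 2) # (n + 1) # tl xs"

lemma Cons_max_admissible_iff:
  "Suc n # xs \<in> admissible (Suc n) \<longleftrightarrow> xs \<in> admissible n"
proof -
  have "insert (Suc n) (set xs) = insert (Suc n) {1..n} \<longleftrightarrow> set xs = {1..n}"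
    if "Suc n \<notin> set xs"
    using that by (intro insert_ident) auto
  then have "distinct (Suc n # xs) \<and> set (Suc n # xs) = {1..Suc n} \<longleftrightarrow>
      distinct xs \<and> set xs = {1..n}"
    by (auto simp: atLeastAtMostSuc_conv)
  moreover have "\<forall>y\<in>set xs. y < Suc n" if "set xs = {1..n}"
    using that by auto
  ultimately show ?thesis
    unfolding admissible_def
    using jacobi_Cons_max_iff at_most_one_smaller_before_Cons_max_iff by blast
qed

lemma insert_two_max_admissible_iff:
  assumes "a \<le> n"
  shows "a # (n + 2) # (n + 1) # ys \<in> admissible (n + 2) \<longleftrightarrow> a # ys \<in> admissible n"
proof -
  have split: "{1..n + 2} = insert (n + 2) (insert (n + 1) {1..n})" by auto
  have "distinct (a # (n + 2) # (n + 1) # ys) \<and> set (a # (n + 2) # (n + 1) # ys) = {1..n + 2}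
      \<longleftrightarrow> distinct (a # ys) \<and> set (a # ys) = {1..n}"
    (is "?L \<longleftrightarrow> ?R")
  proof
    assume L: ?L
    then have "set (a # ys) = {1..n + 2} - {n + 2, n + 1}"
      using assms by auto
    also have "\<dots> = {1..n}" by auto
    finally show ?R using L by simp
  next
    assume R: ?R
    then have "n + 1 \<notin> set (a # ys)" "n + 2 \<notin> set (a # ys)" by auto
    then show ?L using R split by auto
  qed
  moreover have "a \<notin> set ys \<and> (\<forall>y\<in>set ys. y < n + 1)"
    if "distinct (a # ys) \<and> set (a # ys) = {1..n}"
    using that by force
  moreover have "a < n + 1" "n + 1 < n + 2" using assms by auto
  ultimately show ?thesis
    unfolding admissible_def mem_Collect_eq
    using jacobi_insert_two_max_iff[of a "n + 1" "n + 2" ys]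
      at_most_one_smaller_before_insert_two_max_iff[of a "n + 1" "n + 2" ys]
    by meson
qed

lemma admissible_rec:
  assumes "n \<ge> 1"
  shows "admissible (n + 2) = Cons (n + 2) ` admissible (n + 1) \<union> insert_two_max n ` admissible n"
proof (intro equalityI subsetI)
  fix xs assume xs: "xs \<in> admissible (n + 2)"
  then have dist: "distinct xs" and set: "set xs = {1..n + 2}" and jac: "jacobi xs"
    and amo: "\<And>a b c. subseq [a, b, c] xs \<Longrightarrow> \<not> (a < c \<and> b < c)"
    by (auto simp: admissible_def at_most_one_smaller_before_def)
  have "length xs = n + 2"
    using distinct_card[OF dist] set by simp
  \<comment> \<open>As \<open>n \<ge> 1\<close>, three leading letters exist and can be
    named.\<close>
  with assms have "Suc (Suc (Suc 0)) \<le> length xs" by simp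
  then obtain a b c zs where eq: "xs = a # b # c # zs"
    by (auto simp: Suc_le_length_iff)
  have third: "\<not> (a < z \<and> b < z)" if "z \<in> set (c # zs)" for z
  proof -
    have "subseq [z] (c # zs)" using that by (simp only: subseq_singleton_left)
    then have "subseq [a, b, z] xs" by (simp only: eq subseq_Cons2_iff if_True refl)
    then show ?thesis by (rule amo)
  qed
  have bound: "y \<le> n + 2" if "y \<in> set xs" for y
    using that set by auto
  show "xs \<in> Cons (n + 2) ` admissible (n + 1) \<union> insert_two_max n ` admissible n"
  proof (cases "a = n + 2")
    case True
    then show ?thesis
      using xs Cons_max_admissible_iff[of "n + 1" "b # c # zs"] by (auto simp: eq)
  next
    case False
    then have a: "a < n + 2" using bound[of a] by (auto simp: eq)
    \<comment> \<open>Otherwise the maximum comes after the two smaller letters \<open>a\<close> and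
      \<open>b\<close>.\<close>
    have b: "b = n + 2"
    proof (rule ccontr)
      assume "b \<noteq> n + 2"
      then have "b < n + 2" using bound[of b] by (auto simp: eq)
      moreover have "n + 2 \<in> set (c # zs)"
      proof -
        have "n + 2 \<in> set xs" unfolding set by simp
        with a \<open>b \<noteq> n + 2\<close> show ?thesis by (simp add: eq)
      qed
      ultimately show False using third a by blast
    qed
    have "even (length (takeWhile (\<lambda>y. a < y) (b # c # zs)))"
      using jac dist by (auto simp: eq jacobi_Cons_iff)
    \<comment> \<open>If \<open>c\<close> were not larger than \<open>a\<close>, then
      \<open>rho\<close> of \<open>a\<close> would be \<open>[b]\<close>, of odd length.\<close>
    then have "a < c" using a b by (auto split: if_splits)
    have "c \<le> n + 1" using bound[of c] dist b by (auto simp: eq)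
    \<comment> \<open>Otherwise \<open>n + 1\<close> stands in \<open>zs\<close>, after the smaller
      letters \<open>a\<close> and \<open>c\<close>.\<close>
    have c: "c = n + 1"
    proof (rule ccontr)
      assume "c \<noteq> n + 1"
      have "n + 1 \<in> set xs" unfolding set by simp
      then have "n + 1 \<in> set zs"
        using b \<open>a < c\<close> \<open>c \<le> n + 1\<close> \<open>c \<noteq> n + 1\<close> by (simp add: eq)
      then have "subseq [n + 1] zs" by (simp only: subseq_singleton_left)
      then have "subseq [a, c, n + 1] xs"
        unfolding eq by (intro subseq_Cons2 list_emb_Cons)
      then show False
        using amo[of a c "n + 1"] \<open>a < c\<close> \<open>c \<le> n + 1\<close> \<open>c \<noteq> n + 1\<close> by auto
    qed
    have "a # zs \<in> admissible n"
      using xs \<open>a < c\<close> insert_two_max_admissible_iff[of a n zs] by (simp add: eq b c)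
    moreover have "xs = insert_two_max n (a # zs)"
      by (simp add: insert_two_max_def eq b c)
    ultimately show ?thesis by blast
  qed
next
  fix xs
  assume "xs \<in> Cons (n + 2) ` admissible (n + 1) \<union> insert_two_max n ` admissible n"
  then consider (Cons) ys where "ys \<in> admissible (n + 1)" "xs = (n + 2) # ys"
    | (two) ys where "ys \<in> admissible n" "xs = insert_two_max n ys" by blast
  then show "xs \<in> admissible (n + 2)"
  proof cases
    case Cons
    then show ?thesis using Cons_max_admissible_iff[of "n + 1" ys] by simp
  next
    case two
    then have set: "set ys = {1..n}" by (simp add: admissible_def)
    with assms obtain a zs where ys: "ys = a # zs" by (cases ys) auto
    with set have "a \<le> n" by auto
    with two ys show ?thesis
      using insert_two_max_admissible_iff[of a n zs] by (simp add: insert_two_max_def)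
  qed
qed

lemma card_admissible_rec:
  assumes "n \<ge> 1"
  shows "card (admissible (n + 2)) = card (admissible (n + 1)) + card (admissible n)"
proof -
  have set: "set ys = {1..n}" if "ys \<in> admissible n" for ys
    using that by (simp add: admissible_def)
  then have ne: "ys \<noteq> []" if "ys \<in> admissible n" for ys
    using assms that by fastforce
  have "inj_on (insert_two_max n) (admissible n)"
    using ne by (intro inj_onI) (auto simp: insert_two_max_def intro: list.expand)
  \<comment> \<open>The first letter separates the two images: it is \<open>n + 2\<close> in one and
    at most \<open>n\<close> in the other.\<close>
  moreover have "hd ys \<noteq> n + 2" if "ys \<in> admissible n" for ys
    using hd_in_set[OF ne[OF that]] set[OF that] by auto
  then have "Cons (n + 2) ` admissible (n + 1) \<inter> insert_two_max n ` admissible n = {}"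
    by (fastforce simp: insert_two_max_def)
  ultimately show ?thesis
    unfolding admissible_rec[OF assms]
    by (simp add: card_Un_disjoint finite_admissible card_image)
qed

section \<open>Initial values and the Fibonacci count\<close>

lemma admissible_0: "admissible 0 = {[]}"
  by (auto simp: admissible_def jacobi_def at_most_one_smaller_before_def)

lemma admissible_1: "admissible 1 = {[1]}"
proof -
  have "xs = [1]" if "xs \<in> admissible 1" for xs
  proof -
    have "distinct xs" and set: "set xs = {1}" using that by (simp_all add: admissible_def)
    then have "length xs = Suc 0" using distinct_card[of xs] by simp
    then obtain a where "xs = [a]" by (auto simp only: length_Suc_conv length_0_conv)
    with set show ?thesis by simp
  qed
  moreover have "[1] \<in> admissible 1"
    using Cons_max_admissible_iff[of 0 "[]"] by (simp add: admissible_0)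
  ultimately show ?thesis by blast
qed

text \<open>In \<open>[1, 2]\<close> the letter 1 has a \<open>rho\<close> of length one. This size
  needs its own treatment: the recurrence at \<open>n = 0\<close> would give two words.\<close>

lemma admissible_2: "admissible 2 = {[2, 1]}"
proof -
  have "xs = [2, 1]" if "xs \<in> admissible 2" for xs
  proof -
    have "{1..2::nat} = {1, 2}" by auto
    with that have "distinct xs" and set: "set xs = {1, 2}" and jac: "jacobi xs"
      unfolding admissible_def by blast+
    then have "length xs = Suc (Suc 0)" using distinct_card[of xs] by simp
    then obtain a b where "xs = [a, b]" by (auto simp: length_Suc_conv)
    with set jac show ?thesis by (auto simp: doubleton_eq_iff jacobi_Cons_iff)
  qed
  moreover have "[2, 1] \<in> admissible 2"
    using Cons_max_admissible_iff[of 1 "[1]"] admissible_1 by (simp add: numeral_2_eq_2)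
  ultimately show ?thesis by blast
qed

lemma card_admissible_Suc: "card (admissible (Suc n)) = fibonacci n"
proof (induction n rule: fibonacci.induct)
  case 1
  show ?case using admissible_1 by simp
next
  case 2
  show ?case using admissible_2 by (simp add: numeral_2_eq_2)
next
  case (3 m)
  then show ?case using card_admissible_rec[of "Suc m"] by simp
qed

theorem theorem8p4:
  fixes n :: nat
  assumes "n \<ge> 1"
  shows "jacobi_count n {[1, 2, 3], [2, 1, 3]} = fibonacci (n - 1)"
  unfolding jacobi_count_eq_card_admissible
  using assms card_admissible_Suc[of "n - 1"] by simp

end
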